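(* The complete graph $K_a$ on $a$ vertices can be embedded in a Steiner triple system of order $3a$ if $a$ is odd, and in a Steiner triple system of order $3a+1$ if $a$ is even. In both cases these are the minimum orders possible to embed $K_a$; that is, $K_a$ cannot be embedded in any Steiner triple system of order smaller than $3a$ when $a$ is odd, respectively smaller than $3a+1$ when $a$ is even.
   Context: A Steiner triple system of order $v$, denoted $\mathrm{STS}(v)$, is a pair $(V,\mathcal B)$ with $|V|=v$ and $\mathcal B$ a collection of 3-subsets (blocks) of $V$ such that every 2-subset of $V$ lies in exactly one block. Embedding of a graph in an STS. In the game Nofil on an STS, players alternately choose ("play") points, never completing a block of played points. At any stage the points are partitioned into $P$ (played), $U$ (unplayable: unplayed points lying on a block whose other two points are in $P$) and $A$ (available: all other points). The available hypergraph has vertex set $A$ and a hyperedge $B\setminus P$ for each block $B$ with $B\cap U=\emptyset$. A graph $G$ is embedded in the STS if it is (isomorphic to) an available hypergraph that can be reached in some play of Nofil on the STS. Equivalently: there is a partition $V=P\sqcup A\sqcup U$ and an identification of $A$ with the vertex set of $G$ such that (i) no block is contained in $P$, and no block has two points in $P$ and one point in $A$; (ii) every point of $U$ lies on some block whose other two points are in $P$; (iii) for each edge $xy$ of $G$, the block containing $x,y$ has its third point in $P$; (iv) for each pair of distinct non-adjacent vertices $x,y$ of $G$, the block containing $x,y$ has its third point in $U$.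
   Formalization: The formal statement assumes a ≥ 3; without this the claim fails, since K_1 embeds in the system of order 1 (below 3), K_2 embeds in the system of order 3 (below 7), and the empty graph embeds in the system of order 0. *)

theory Defs
  imports "HOL-Library.Ramsey"
begin

definition steiner_triple_system :: "nat \<Rightarrow> 'a set \<Rightarrow> 'a set set \<Rightarrow> bool" where
  "steiner_triple_system v V B \<longleftrightarrow>
     finite V \<and> card V = v \<and> B \<subseteq> [V]\<^bsup>3\<^esup> \<and> (\<forall>e \<in> [V]\<^bsup>2\<^esup>. \<exists>!b. b \<in> B \<and> e \<subseteq> b)"

text \<open>A position of Nofil on \<open>(V, B)\<close> is given by its set \<open>P\<close> of played points.\<close>

definition unplayable :: "'a set \<Rightarrow> 'a set set \<Rightarrow> 'a set \<Rightarrow> 'a set" where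
  "unplayable V B P = {z \<in> V - P. \<exists>b \<in> B. z \<in> b \<and> b - {z} \<subseteq> P}"

definition available :: "'a set \<Rightarrow> 'a set set \<Rightarrow> 'a set \<Rightarrow> 'a set" where
  "available V B P = V - P - unplayable V B P"

definition available_edges :: "'a set \<Rightarrow> 'a set set \<Rightarrow> 'a set \<Rightarrow> 'a set set" where
  "available_edges V B P = {b - P | b. b \<in> B \<and> b \<inter> unplayable V B P = {}}"

inductive reachable :: "'a set \<Rightarrow> 'a set set \<Rightarrow> 'a set \<Rightarrow> bool" for V B where
  start: "reachable V B {}"
| move: "reachable V B P \<Longrightarrow> x \<in> available V B P \<Longrightarrow> reachable V B (insert x P)"

text \<open>
  A graph or hypergraph is given by its vertex set and its set of edges (as sets of vertices).
\<close>

definition hypergraph_iso :: "'g set \<Rightarrow> 'g set set \<Rightarrow> 'a set \<Rightarrow> 'a set set \<Rightarrow> bool" where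
  "hypergraph_iso W E W' E' \<longleftrightarrow> (\<exists>f. bij_betw f W W' \<and> (\<lambda>e. f ` e) ` E = E')"

definition embedded_in_STS :: "'g set \<Rightarrow> 'g set set \<Rightarrow> 'a set \<Rightarrow> 'a set set \<Rightarrow> bool" where
  "embedded_in_STS W E V B \<longleftrightarrow>
     (\<exists>P. reachable V B P \<and> hypergraph_iso W E (available V B P) (available_edges V B P))"

definition complete_graph_embedded :: "nat \<Rightarrow> 'a set \<Rightarrow> 'a set set \<Rightarrow> bool" where
  "complete_graph_embedded a V B \<longleftrightarrow> embedded_in_STS {..<a} ([{..<a}]\<^bsup>2\<^esup>) V B"

end

theory Submission
  imports Defs
begin

text \<open>
  Let \<open>P\<close>, \<open>A\<close>, \<open>U\<close> be the played, available and unplayable points of an embedding of \<open>K\<^sub>a\<close>.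
  Third points of blocks colour the edges inside \<open>A\<close> properly by \<open>P\<close>, and those inside \<open>P\<close>
  properly by \<open>U\<close>. A proper edge colouring of a complete graph on \<open>m > 1\<close> vertices needs
  \<open>m - 1\<close> colours, and \<open>m\<close> colours if \<open>m\<close> is odd. This gives \<open>v \<ge> 3 * a - 1\<close> for odd \<open>a\<close> and
  \<open>v \<ge> 3 * a - 2\<close> for even \<open>a\<close>; as \<open>v\<close> is odd and 3 divides \<open>v * (v - 1)\<close>, the bounds follow.

  For odd \<open>a\<close>, play one level of the Bose construction: the next level becomes unplayable and the
  third one is the complete graph. For even \<open>a\<close> the same works in the Skolem construction, except
  that the point at infinity is on no block with two played points and so stays available. Exchanging
  infinity with an unplayable point along one Pasch configuration cures this.
\<close>

section \<open>Parity and counting of pairs and blocks\<close>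

text \<open>The orbits \<open>{x, f x}\<close> split \<open>S\<close> into pairs; the induction
  removes one of them.\<close>

lemma even_card_involution:
  assumes "finite S" "\<And>x. x \<in> S \<Longrightarrow> f x \<in> S" "\<And>x. x \<in> S \<Longrightarrow> f (f x) = x" "\<And>x. x \<in> S \<Longrightarrow> f x \<noteq> x"
  shows "even (card S)"
  using assms
proof (induction "card S" arbitrary: S rule: less_induct)
  case less
  show ?case
  proof (cases "S = {}")
    case False
    then obtain x where x: "x \<in> S" by blast
    let ?T = "S - {x, f x}"
    have "{x, f x} \<subseteq> S" "card {x, f x} = 2" using less.prems(2,4)[OF x] x by (auto simp: card_insert_if)
    then have c: "card S = card ?T + 2"
      using less.prems(1) by (metis card_Diff_subset card_mono finite_subset le_add_diff_inverse2)
    have "even (card ?T)"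
    proof (rule less.hyps)
      fix y assume y: "y \<in> ?T"
      then have "f y \<noteq> x" "f y \<noteq> f x" using less.prems(3) x by (metis DiffE insertCI)+
      then show "f y \<in> ?T" using y less.prems(2) by auto
    qed (use c less.prems in auto)
    then show ?thesis using c by simp
  qed simp
qed

lemma card_nsets: "finite A \<Longrightarrow> card ([A]\<^bsup>k\<^esup>) = card A choose k"
  by (metis (no_types, lifting) Collect_cong finite_subset n_subsets nsets_def)

text \<open>Double counting of incident pairs and blocks: each block contains three pairs. Both the
  exact count of blocks and the criterion for being a Steiner triple system rest on it.\<close>

lemma sum_blocks_through_pair:
  assumes "finite V" "B \<subseteq> [V]\<^bsup>3\<^esup>"
  shows "(\<Sum>e \<in> [V]\<^bsup>2\<^esup>. card {b \<in> B. e \<subseteq> b}) = 3 * card B"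
proof -
  have fB: "finite B" using assms finite_imp_finite_nsets finite_subset by blast
  have "card {e \<in> [V]\<^bsup>2\<^esup>. e \<subseteq> b} = 3" if "b \<in> B" for b
  proof -
    have b: "finite b" "card b = 3" "b \<subseteq> V" using that assms(2) by (auto simp: nsets_def)
    have "{e \<in> [V]\<^bsup>2\<^esup>. e \<subseteq> b} = [b]\<^bsup>2\<^esup>" using b by (auto simp: nsets_def)
    then show ?thesis using card_nsets[of b 2] b by (simp add: choose_two)
  qed
  then show ?thesis
    using sum_multicount[of "[V]\<^bsup>2\<^esup>" B "\<lambda>e b. e \<subseteq> b" 3] assms fB by (simp add: finite_imp_finite_nsets)
qed

lemma card_blocks:
  assumes "steiner_triple_system v V B"
  shows "6 * card B = v * (v - 1)"
proof -
  have V: "finite V" "card V = v" "B \<subseteq> [V]\<^bsup>3\<^esup>"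
    and ex: "\<And>e. e \<in> [V]\<^bsup>2\<^esup> \<Longrightarrow> \<exists>!b. b \<in> B \<and> e \<subseteq> b"
    using assms unfolding steiner_triple_system_def by auto
  have "card {b \<in> B. e \<subseteq> b} = 1" if e: "e \<in> [V]\<^bsup>2\<^esup>" for e
  proof -
    obtain b where "{b \<in> B. e \<subseteq> b} = {b}" using ex[OF e] by blast
    then show ?thesis by simp
  qed
  then have "card ([V]\<^bsup>2\<^esup>) = 3 * card B" using sum_blocks_through_pair[OF V(1,3)] by simp
  then have "v * (v - 1) div 2 = 3 * card B" using V card_nsets[of V 2] by (simp add: choose_two)
  moreover have "even (v * (v - 1))" by (cases v) auto
  ultimately show ?thesis by (elim evenE) simp
qed

text \<open>With at most \<open>v(v - 1)/6\<close> blocks, covering all pairs leaves no room for covering one twice.\<close>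

lemma steiner_triple_systemI:
  assumes V: "finite V" "card V = v" and B: "B \<subseteq> [V]\<^bsup>3\<^esup>"
    and card_B: "6 * card B \<le> v * (v - 1)"
    and cover: "\<And>x y. x \<in> V \<Longrightarrow> y \<in> V \<Longrightarrow> x \<noteq> y \<Longrightarrow> \<exists>b \<in> B. x \<in> b \<and> y \<in> b"
  shows "steiner_triple_system v V B"
  unfolding steiner_triple_system_def
proof (intro conjI ballI V B)
  fix e assume e: "e \<in> [V]\<^bsup>2\<^esup>"
  let ?n = "\<lambda>e. card {b \<in> B. e \<subseteq> b}"
  have fB: "finite B" using V B finite_imp_finite_nsets finite_subset by blast
  have ge: "?n e \<ge> 1" if e: "e \<in> [V]\<^bsup>2\<^esup>" for e
  proof -
    obtain x y where "e = {x, y}" "x \<in> V" "y \<in> V" "x \<noteq> y" using e by (auto simp: nsets_2_eq)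
    then have "{b \<in> B. e \<subseteq> b} \<noteq> {}" using cover[of x y] by auto
    then show ?thesis using fB by (simp add: Suc_le_eq card_gt_0_iff)
  qed
  have "even (v * (v - 1))" by (cases v) auto
  then have "2 * (v choose 2) = v * (v - 1)" unfolding choose_two by (rule dvd_mult_div_cancel)
  then have "3 * card B \<le> (\<Sum>e \<in> [V]\<^bsup>2\<^esup>. 1)" using card_B V card_nsets[of V 2] by simp
  then have "(\<Sum>e \<in> [V]\<^bsup>2\<^esup>. ?n e) \<le> (\<Sum>e \<in> [V]\<^bsup>2\<^esup>. 1)" using sum_blocks_through_pair[OF V(1) B] by simp
  then have "?n e = 1"
    using sum_mono_inv[of "\<lambda>_. 1" "[V]\<^bsup>2\<^esup>" ?n e] sum_mono[of "[V]\<^bsup>2\<^esup>" "\<lambda>_. 1" ?n]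
      ge e finite_imp_finite_nsets[OF V(1)] by fastforce
  then obtain c where "{b \<in> B. e \<subseteq> b} = {c}" using card_1_singletonE by blast
  then have "b \<in> B \<and> e \<subseteq> b \<longleftrightarrow> b = c" for b by (simp add: set_eq_iff)
  then show "\<exists>!b. b \<in> B \<and> e \<subseteq> b" by simp
qed

section \<open>Arithmetic of the lower bound\<close>

lemma sts_order_bound_from_parts:
  fixes a p u v :: nat
  assumes "a \<ge> 3" "v = a + p + u" "a \<le> p + 1" "odd a \<Longrightarrow> a \<le> p" "p \<le> u + 1" "odd p \<Longrightarrow> p \<le> u"
    and v: "odd v" "3 dvd v * (v - 1)"
  shows "odd a \<Longrightarrow> v \<ge> 3 * a" and "even a \<Longrightarrow> v \<ge> 3 * a + 1"
proof -
  have odd: "v \<ge> 3 * a - 1" if "odd a" using assms that by linarith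
  then show "v \<ge> 3 * a" if "odd a" using that v(1) by presburger
  assume even: "even a"
  have "v \<ge> 3 * a - 2"
  \<comment> \<open>For even \<open>a\<close>, the value \<open>p = a - 1\<close> is odd and forces
    \<open>u \<ge> p\<close>; otherwise \<open>p \<ge> a\<close> and
    \<open>u \<ge> a - 1\<close>.\<close>
  proof (cases "p = a - 1")
    case True
    then have "p \<le> u" using even assms by simp
    then show ?thesis using assms True by linarith
  next
    case False
    then show ?thesis using assms by linarith
  qed
  \<comment> \<open>For even \<open>a\<close>, parity rules out \<open>3 * a - 2\<close> and
    \<open>3 * a\<close>. The odd value \<open>3 * a - 1\<close> is 2 modulo 3, which contradicts
    the divisibility.\<close>
  moreover have "v \<noteq> 3 * a - 1"
  proof
    assume v': "v = 3 * a - 1"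
    obtain k where "a = Suc k" using assms(1) by (cases a) auto
    then have "v = 2 + 3 * k" "v - 1 = 1 + 3 * k" using v' by auto
    then have "v mod 3 = 2" "(v - 1) mod 3 = 1" by presburger+
    then have "v * (v - 1) mod 3 = 2" by (simp add: mod_mult_eq[symmetric])
    then show False using v(2) by simp
  qed
  ultimately show "v \<ge> 3 * a + 1" using v(1) even assms(1) by presburger
qed

section \<open>Third points of blocks and the edge colourings they induce\<close>

text \<open>A total function by definite description; in a Steiner triple system the value is
  meaningful for distinct points of \<open>V\<close>, where \<open>third_block\<close> guarantees
  existence and \<open>third_eq\<close> uniqueness.\<close>

definition third :: "'a set set \<Rightarrow> 'a \<Rightarrow> 'a \<Rightarrow> 'a" where
  "third B x y = (THE z. {x, y, z} \<in> B)"

context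
  fixes v :: nat and V :: "'a set" and B
  assumes sts: "steiner_triple_system v V B"
begin

lemma sts_finite: "finite V" and sts_card: "card V = v"
  using sts unfolding steiner_triple_system_def by auto

lemma block_distinct: "{x, y, z} \<in> B \<Longrightarrow> x \<in> V \<and> y \<in> V \<and> z \<in> V \<and> x \<noteq> y \<and> x \<noteq> z \<and> y \<noteq> z"
  using sts unfolding steiner_triple_system_def nsets_def
  by (auto dest: subsetD simp: card_insert_if split: if_splits)

lemma block_unique:
  assumes "b \<in> B" "c \<in> B" "x \<in> b" "y \<in> b" "x \<in> c" "y \<in> c" "x \<noteq> y"
  shows "b = c"
proof -
  have "b \<subseteq> V" using sts assms(1) unfolding steiner_triple_system_def nsets_def by auto
  then have "{x, y} \<in> [V]\<^bsup>2\<^esup>" using assms by auto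
  then have "\<exists>!d. d \<in> B \<and> {x, y} \<subseteq> d" using sts unfolding steiner_triple_system_def by blast
  moreover have "b \<in> B \<and> {x, y} \<subseteq> b" "c \<in> B \<and> {x, y} \<subseteq> c" using assms by auto
  ultimately show ?thesis by (elim ex1E) metis
qed

lemma third_eq:
  assumes "{x, y, z} \<in> B"
  shows "third B x y = z"
  unfolding third_def
proof (rule the_equality)
  show "{x, y, z} \<in> B" by (rule assms)
next
  fix w assume w: "{x, y, w} \<in> B"
  have "{x, y, w} = {x, y, z}"
    using block_unique[OF w assms, of x y] block_distinct[OF assms] by auto
  then show "w = z" using block_distinct[OF assms] block_distinct[OF w] by auto
qed

lemma third_block:
  assumes "x \<in> V" "y \<in> V" "x \<noteq> y"
  shows "{x, y, third B x y} \<in> B"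
proof -
  have "{x, y} \<in> [V]\<^bsup>2\<^esup>" using assms by simp
  then obtain b where b: "b \<in> B" "{x, y} \<subseteq> b" using sts unfolding steiner_triple_system_def by blast
  then have "card b = 3" using sts unfolding steiner_triple_system_def nsets_def by auto
  then have "card (b - {x, y}) = 1" using b assms by (simp add: card_Diff_subset)
  then obtain z where "b - {x, y} = {z}" using card_1_singletonE by blast
  then have "b = {x, y, z}" using b by auto
  then show ?thesis using b third_eq by auto
qed

text \<open>One block read from two of its pairs. So \<open>third B x\<close> is an involution on
  the points other than \<open>x\<close>, the source of all the parity arguments.\<close>

lemma third_third:
  assumes "x \<in> V" "y \<in> V" "x \<noteq> y"
  shows "third B x (third B x y) = y"
  using third_eq[of x "third B x y" y] third_block[OF assms] by (simp add: insert_commute)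

lemma third_commute:
  assumes "x \<in> V" "y \<in> V" "x \<noteq> y"
  shows "third B y x = third B x y"
  using third_eq[of y x "third B x y"] third_block[OF assms] by (simp add: insert_commute)

text \<open>The blocks through a fixed point \<open>x\<close> split the other points into pairs,
  swapped by \<open>third B x\<close>.\<close>

lemma odd_order:
  assumes "v > 0"
  shows "odd v"
proof -
  obtain x where x: "x \<in> V" using assms sts_card by fastforce
  have "even (card (V - {x}))"
  proof (rule even_card_involution)
    fix y assume y: "y \<in> V - {x}"
    then have b: "{x, y, third B x y} \<in> B" using third_block x by blast
    show "third B x y \<in> V - {x}" "third B x y \<noteq> y" using block_distinct[OF b] by auto
    show "third B x (third B x y) = y" using third_third x y by blast
  qed (simp add: sts_finite)
  then show ?thesis using x sts_finite sts_card by auto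
qed

lemma three_dvd_order: "3 dvd v * (v - 1)"
  using card_blocks[OF sts] by presburger

text \<open>The third points form a proper edge colouring of the complete graph on \<open>S\<close> with
  colours \<open>T\<close>; for odd \<open>S\<close> no colour class is a perfect matching.\<close>

lemma card_third_points:
  assumes S: "S \<subseteq> V" and T: "T \<subseteq> V" and ST: "S \<inter> T = {}" and two: "card S \<ge> 2"
    and col: "\<And>x y. x \<in> S \<Longrightarrow> y \<in> S \<Longrightarrow> x \<noteq> y \<Longrightarrow> third B x y \<in> T"
  shows "card S \<le> card T + 1" and "odd (card S) \<Longrightarrow> card S \<le> card T"
proof -
  have fin: "finite S" "finite T" using S T sts_finite finite_subset by blast+
  \<comment> \<open>Properness of the colouring: two edges at \<open>x\<close> never share a
    colour.\<close>
  have inj: "inj_on (third B x) (S - {x})" if "x \<in> S" for x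
    using that S third_third by (intro inj_on_inverseI[of _ "third B x"]) auto
  have sub: "third B x ` (S - {x}) \<subseteq> T" if "x \<in> S" for x using col that by auto
  obtain x where x: "x \<in> S" using two by fastforce
  show le: "card S \<le> card T + 1"
    using card_inj_on_le[OF inj sub fin(2)] x fin two by fastforce
  assume odd: "odd (card S)"
  show "card S \<le> card T"
  proof (rule ccontr)
    assume "\<not> ?thesis"
    then have eq: "card S = card T + 1" using le by simp
    then obtain t where t: "t \<in> T" using two by fastforce
    \<comment> \<open>With only \<open>card S - 1\<close> colours every vertex meets every colour,
      so the edges of colour \<open>t\<close> form a perfect matching, in which
      \<open>third B x t\<close> is the partner of \<open>x\<close>.\<close>
    have onto: "third B x ` (S - {x}) = T" if "x \<in> S" for x
      using that eq fin by (intro card_subset_eq sub) (simp_all add: card_image inj)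
    have "even (card S)"
    proof (rule even_card_involution[OF fin(1), of "\<lambda>x. third B x t"])
      fix x assume x: "x \<in> S"
      then obtain y where y: "y \<in> S" "y \<noteq> x" "t = third B x y" using onto[OF x] t by auto
      then have ty: "third B x t = y" using third_third x S by auto
      show "third B x t \<in> S" "third B x t \<noteq> x" using ty y by auto
      have "third B y t = x" using y third_third[of y x] third_commute[of x y] x S by auto
      then show "third B (third B x t) t = x" using ty by simp
    qed
    then show False using odd by simp
  qed
qed

section \<open>Reachable positions and the lower bound\<close>

text \<open>A move completing a block would play an unplayable point. Conversely, subsets of a
  block-free set are block-free, so its points can be played in any order.\<close>

lemma reachable_iff: "reachable V B P \<longleftrightarrow> P \<subseteq> V \<and> (\<forall>b \<in> B. \<not> b \<subseteq> P)"
proof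
  assume "reachable V B P"
  then show "P \<subseteq> V \<and> (\<forall>b \<in> B. \<not> b \<subseteq> P)"
  proof induction
    case start
    show ?case using sts unfolding steiner_triple_system_def nsets_def by auto
  next
    case (move P x)
    have "\<not> b \<subseteq> insert x P" if "b \<in> B" for b
    proof
      assume b: "b \<subseteq> insert x P"
      then have "x \<in> b" "b - {x} \<subseteq> P" using move that by auto
      then show False using move.hyps that unfolding available_def unplayable_def by blast
    qed
    then show ?case using move unfolding available_def by auto
  qed
next
  assume P: "P \<subseteq> V \<and> (\<forall>b \<in> B. \<not> b \<subseteq> P)"
  then have "finite P" using sts_finite finite_subset by blast
  then show "reachable V B P" using P
  proof (induction P)
    case empty
    show ?case by (rule reachable.start)
  next
    case (insert x P)
    have "x \<notin> unplayable V B P"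
      using insert.prems unfolding unplayable_def by blast
    then have "x \<in> available V B P" using insert unfolding available_def by auto
    moreover have "reachable V B P" using insert by blast
    ultimately show ?case by (rule reachable.move[rotated])
  qed
qed

lemma complete_graph_order_bound:
  assumes a: "a \<ge> 3" and emb: "complete_graph_embedded a V B"
  shows "odd a \<Longrightarrow> v \<ge> 3 * a" and "even a \<Longrightarrow> v \<ge> 3 * a + 1"
proof -
  from emb obtain P where "reachable V B P"
    and iso: "hypergraph_iso {..<a} ([{..<a}]\<^bsup>2\<^esup>) (available V B P) (available_edges V B P)"
    unfolding complete_graph_embedded_def embedded_in_STS_def by blast
  then have P: "P \<subseteq> V" "\<And>b. b \<in> B \<Longrightarrow> \<not> b \<subseteq> P" using reachable_iff by auto
  define A where "A = available V B P"
  define U where "U = unplayable V B P"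
  have part: "A = V - P - U" "U \<subseteq> V - P"
    unfolding A_def U_def available_def unplayable_def by auto
  from iso obtain f where f: "bij_betw f {..<a} A"
    and edges: "(\<lambda>e. f ` e) ` [{..<a}]\<^bsup>2\<^esup> = available_edges V B P"
    unfolding hypergraph_iso_def A_def by blast
  have cA: "card A = a" using bij_betw_same_card[OF f] by simp
  \<comment> \<open>The edge \<open>{x, y}\<close> is what remains of some block after removing the
    played points. That block must be the one through \<open>x\<close> and \<open>y\<close>, so its
    third point has been played.\<close>
  have AP: "third B x y \<in> P" if xy: "x \<in> A" "y \<in> A" "x \<noteq> y" for x y
  proof -
    obtain i j where ij: "i < a" "j < a" "x = f i" "y = f j" "i \<noteq> j"
      using xy bij_betw_imp_surj_on[OF f] by (metis imageE lessThan_iff)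
    then have "{x, y} = f ` {i, j}" "{i, j} \<in> [{..<a}]\<^bsup>2\<^esup>" by auto
    then have "{x, y} \<in> available_edges V B P" using edges by blast
    then obtain b where b: "b \<in> B" "{x, y} = b - P" unfolding available_edges_def by blast
    have "x \<in> V" "y \<in> V" using xy part by auto
    then have t: "{x, y, third B x y} \<in> B" using third_block[OF _ _ xy(3)] by blast
    have "x \<in> b" "y \<in> b" using b(2) by blast+
    then have "b = {x, y, third B x y}" using block_unique[OF b(1) t] xy(3) by blast
    then have "third B x y \<in> b" by blast
    moreover have "third B x y \<notin> b - P" using block_distinct[OF t] by (auto simp flip: b(2))
    ultimately show ?thesis by blast
  qed
  have PU: "third B x y \<in> U" if "x \<in> P" "y \<in> P" "x \<noteq> y" for x y
  proof -
    have t: "{x, y, third B x y} \<in> B" using third_block[of x y] that P(1) by blast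
    then have "third B x y \<notin> P" using P(2)[OF t] that by auto
    then have "third B x y \<in> V - P" using block_distinct[OF t] by blast
    moreover have "\<exists>b \<in> B. third B x y \<in> b \<and> b - {third B x y} \<subseteq> P"
      by (rule bexI[OF _ t]) (use that in blast)
    ultimately show ?thesis unfolding U_def unplayable_def by simp
  qed
  have fin: "finite P" "finite U" "finite A"
    using finite_subset[OF P(1) sts_finite] finite_subset[OF part(2)] part(1) sts_finite by auto
  have "V = A \<union> (P \<union> U)" "A \<inter> (P \<union> U) = {}" "P \<inter> U = {}" using part P by auto
  then have v: "v = a + card P + card U"
    using sts_card fin cA by (simp add: card_Un_disjoint)
  have 1: "a \<le> card P + 1" "odd a \<Longrightarrow> a \<le> card P"
    using card_third_points[of A P] AP part P cA a by auto
  \<comment> \<open>The colouring bound needs two played points; they exist because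
    \<open>a \<ge> 3\<close> and \<open>a \<le> card P + 1\<close>.\<close>
  have 2: "card P \<le> card U + 1" "odd (card P) \<Longrightarrow> card P \<le> card U"
    using card_third_points[of P U] PU part P 1 a by auto
  have "odd v" using odd_order v a by simp
  then show "odd a \<Longrightarrow> v \<ge> 3 * a" "even a \<Longrightarrow> v \<ge> 3 * a + 1"
    using sts_order_bound_from_parts[OF a v 1 2] three_dvd_order by blast+
qed

end

section \<open>Pasch switches and a criterion for embedding complete graphs\<close>

text \<open>Exchanging \<open>p\<close> and \<open>q\<close> in the four blocks of a Pasch
  configuration leaves the twelve covered pairs the same.\<close>

lemma pasch_switch:
  assumes sts: "steiner_triple_system v V B" and dist: "distinct [p, q, b, c, d, e]"
    and old: "{{p, b, c}, {p, d, e}, {q, b, e}, {q, c, d}} \<subseteq> B"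
  shows "steiner_triple_system v V
    (B - {{p, b, c}, {p, d, e}, {q, b, e}, {q, c, d}} \<union> {{q, b, c}, {q, d, e}, {p, b, e}, {p, c, d}})"
    (is "steiner_triple_system v V (B - ?old \<union> ?new)")
proof (rule steiner_triple_systemI)
  have V: "finite V" "card V = v" "B \<subseteq> [V]\<^bsup>3\<^esup>"
    using sts unfolding steiner_triple_system_def by auto
  then show "finite V" "card V = v" by simp_all
  have sub: "\<Union>?old \<subseteq> V" using old V(3) unfolding nsets_def by blast
  then have "?new \<subseteq> [V]\<^bsup>3\<^esup>" using dist by (simp add: nsets_def card_insert_if)
  then show "B - ?old \<union> ?new \<subseteq> [V]\<^bsup>3\<^esup>" using V(3) by blast
  have fB: "finite B" using V finite_imp_finite_nsets finite_subset by blast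
  \<comment> \<open>Four distinct blocks leave and at most four enter, so the number of blocks does
    not grow.\<close>
  have "{p, b, c} \<noteq> {p, d, e}" "{p, b, c} \<noteq> {q, b, e}" "{p, b, c} \<noteq> {q, c, d}"
    "{p, d, e} \<noteq> {q, b, e}" "{p, d, e} \<noteq> {q, c, d}" "{q, b, e} \<noteq> {q, c, d}"
    using dist by (auto dest!: equalityD1)
  then have "card ?old = 4" by simp
  then have "card (B - ?old) + 4 = card B"
    using old fB card_mono[OF fB old] card_Diff_subset[of ?old B] by simp
  moreover have "card ?new \<le> 4" by (simp add: card_insert_if)
  ultimately have "card (B - ?old \<union> ?new) \<le> card B"
    using card_Un_le[of "B - ?old" ?new] by linarith
  then show "6 * card (B - ?old \<union> ?new) \<le> v * (v - 1)" using card_blocks[OF sts] by linarith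
  fix x y assume xy: "x \<in> V" "y \<in> V" "x \<noteq> y"
  define k where "k = {x, y, third B x y}"
  have k: "k \<in> B" "x \<in> k" "y \<in> k" using third_block[OF sts xy] k_def by auto
  show "\<exists>k \<in> B - ?old \<union> ?new. x \<in> k \<and> y \<in> k"
  proof (cases "k \<in> ?old")
    case True
    then have "\<exists>k \<in> ?new. x \<in> k \<and> y \<in> k" using k(2,3) xy(3) by auto
    then show ?thesis unfolding bex_Un ..
  next
    case False
    then have "k \<in> B - ?old \<union> ?new" using k(1) by (intro UnI1 DiffI)
    then show ?thesis using k(2,3) by (intro bexI[of _ k] conjI)
  qed
qed

text \<open>A block of the second shape has a point in \<open>U\<close> and at most one in
  \<open>A\<close>. Hence two points of \<open>A\<close> meet only in blocks of the first shape,
  which gives all edges, and a block with two played points has its third point in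
  \<open>U\<close>.\<close>

lemma complete_graph_embeddedI:
  assumes sts: "steiner_triple_system v V B"
    and V: "V = P \<union> A \<union> U" "P \<inter> A = {}" "P \<inter> U = {}" "A \<inter> U = {}" and A: "card A = a"
    and blocks: "\<And>b. b \<in> B \<Longrightarrow> \<exists>x y z. b = {x, y, z} \<and> (x \<in> A \<and> y \<in> A \<and> z \<in> P \<or> y \<notin> A \<and> z \<in> U)"
    and U: "\<And>u. u \<in> U \<Longrightarrow> \<exists>x \<in> P. \<exists>y \<in> P. {x, y, u} \<in> B"
  shows "complete_graph_embedded a V B"
proof -
  have unp: "unplayable V B P = U"
  proof (intro equalityI subsetI)
    fix w assume "w \<in> unplayable V B P"
    then obtain b where b: "w \<in> V - P" "b \<in> B" "w \<in> b" "b - {w} \<subseteq> P" unfolding unplayable_def by blast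
    obtain x y z where xyz: "b = {x, y, z}" "x \<in> A \<and> y \<in> A \<and> z \<in> P \<or> y \<notin> A \<and> z \<in> U"
      using blocks[OF b(2)] by blast
    have "x \<noteq> y" using block_distinct[OF sts] b(2) xyz(1) by blast
    then show "w \<in> U" using xyz b V by auto
  next
    fix u assume u: "u \<in> U"
    obtain x y where "x \<in> P" "y \<in> P" "{x, y, u} \<in> B" using U[OF u] by blast
    then have "\<exists>b \<in> B. u \<in> b \<and> b - {u} \<subseteq> P" by (intro bexI[of _ "{x, y, u}"]) auto
    then show "u \<in> unplayable V B P" using u V unfolding unplayable_def by blast
  qed
  then have av: "available V B P = A" using V unfolding available_def by blast
  have "\<not> b \<subseteq> P" if b: "b \<in> B" for b
    using blocks[OF b] V by auto
  then have reach: "reachable V B P" using reachable_iff[OF sts] V(1) by blast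
  have edges: "available_edges V B P = [A]\<^bsup>2\<^esup>"
  proof (intro equalityI subsetI)
    fix e assume "e \<in> available_edges V B P"
    then obtain b where b: "e = b - P" "b \<in> B" "b \<inter> U = {}" unfolding available_edges_def unp by blast
    obtain x y z where xyz: "b = {x, y, z}" "x \<in> A \<and> y \<in> A \<and> z \<in> P \<or> y \<notin> A \<and> z \<in> U"
      using blocks[OF b(2)] by blast
    have "x \<noteq> y" using block_distinct[OF sts] b(2) xyz(1) by blast
    moreover have "x \<in> A" "y \<in> A" "z \<in> P" using xyz b(3) by auto
    moreover from this have "e = {x, y}" using b(1) xyz(1) V by auto
    ultimately show "e \<in> [A]\<^bsup>2\<^esup>" by simp
  next
    fix e assume "e \<in> [A]\<^bsup>2\<^esup>"
    then obtain s t where e: "e = {s, t}" and st: "s \<in> A" "t \<in> A" "s \<noteq> t" by (auto simp: nsets_2_eq)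
    define b where "b = {s, t, third B s t}"
    have b: "b \<in> B" using third_block[OF sts] st V(1) unfolding b_def by blast
    have stb: "s \<in> b" "t \<in> b" unfolding b_def by auto
    obtain x y z where xyz: "b = {x, y, z}" "x \<in> A \<and> y \<in> A \<and> z \<in> P \<or> y \<notin> A \<and> z \<in> U"
      using blocks[OF b] by blast
    \<comment> \<open>The second shape is impossible, since \<open>b\<close> contains the two points
      \<open>s\<close> and \<open>t\<close> of \<open>A\<close>.\<close>
    have z: "x \<in> A" "y \<in> A" "z \<in> P" using xyz st stb V by auto
    then have "e = b - P" using e xyz(1) st stb V by auto
    moreover have "b \<inter> U = {}" using xyz(1) z V by auto
    ultimately show "e \<in> available_edges V B P" using b unfolding available_edges_def unp by blast
  qed
  have "finite A" using sts V(1) unfolding steiner_triple_system_def by auto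
  then obtain f where f: "bij_betw f {..<a} A" using A finite_same_card_bij[of "{..<a}" A] by auto
  then have "(\<lambda>e. f ` e) ` [{..<a}]\<^bsup>2\<^esup> = [A]\<^bsup>2\<^esup>" using bij_betw_nsets[OF f] bij_betw_imp_surj_on by blast
  then show ?thesis
    using reach f unfolding complete_graph_embedded_def embedded_in_STS_def hypergraph_iso_def
    by (metis av edges)
qed

section \<open>Levels and blocks from commutative quasigroups\<close>

lemma less_3_cases: "(i::nat) < 3 \<longleftrightarrow> i = 0 \<or> i = 1 \<or> i = 2"
  by auto

text \<open>The point \<open>(x, i)\<close> of the Bose and Skolem constructions, with \<open>x < a\<close> on level \<open>i < 3\<close>,
  is encoded as \<open>3 * x + i\<close>.\<close>

definition level :: "nat \<Rightarrow> nat \<Rightarrow> nat set" where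
  "level a i = (\<lambda>x. 3 * x + i) ` {..<a}"

lemma mem_level:
  assumes "i < 3" "j < 3"
  shows "3 * x + i \<in> level a j \<longleftrightarrow> i = j \<and> x < a"
proof
  assume "3 * x + i \<in> level a j"
  then obtain y where y: "3 * x + i = 3 * y + j" "y < a" unfolding level_def by blast
  have "(3 * x + i) mod 3 = i" "(3 * y + j) mod 3 = j" using assms by simp_all
  then have "i = j" using y(1) by metis
  then show "i = j \<and> x < a" using y by simp
qed (auto simp: level_def)

text \<open>The levels appear in the order played, available, unplayable expected by
  \<open>complete_graph_embeddedI\<close>.\<close>

lemma level_union: "{..<3 * a} = level a 0 \<union> level a 2 \<union> level a 1"
proof (intro equalityI subsetI)
  fix p assume "p \<in> {..<3 * a}"
  then have "p div 3 < a" by auto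
  moreover have "p = 3 * (p div 3) + 0 \<or> p = 3 * (p div 3) + 2 \<or> p = 3 * (p div 3) + 1" by presburger
  ultimately show "p \<in> level a 0 \<union> level a 2 \<union> level a 1" unfolding level_def by blast
qed (auto simp: level_def)

lemma level_mod: "p \<in> level a i \<Longrightarrow> i < 3 \<Longrightarrow> p mod 3 = i"
  unfolding level_def by (elim imageE) simp

lemma level_disjoint: "i < 3 \<Longrightarrow> j < 3 \<Longrightarrow> i \<noteq> j \<Longrightarrow> level a i \<inter> level a j = {}"
  unfolding disjoint_iff using level_mod by metis

lemma card_level: "card (level a i) = a"
  unfolding level_def by (simp add: card_image inj_on_def)

text \<open>The blocks with two points on level \<open>i\<close> and one on the cyclically next
  level. Indexing by \<open>x < y\<close> lists each unordered pair once, which keeps the count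
  sharp.\<close>

definition level_blocks :: "(nat \<Rightarrow> nat \<Rightarrow> nat) \<Rightarrow> nat \<Rightarrow> nat \<Rightarrow> nat set set" where
  "level_blocks f a i =
     (\<lambda>(y, x). {3 * x + i, 3 * y + i, 3 * f x y + Suc i mod 3}) ` (SIGMA y : {..<a}. {..<y})"

lemma card_level_blocks: "2 * card (level_blocks f a i) \<le> a * (a - 1)"
proof -
  have "card (level_blocks f a i) \<le> card (SIGMA y : {..<a}. {..<y})"
    unfolding level_blocks_def by (rule card_image_le) simp
  also have "\<dots> = (\<Sum>y<a. y)" by simp
  finally have "2 * card (level_blocks f a i) \<le> 2 * (\<Sum>y<a. y)" by simp
  also have "2 * (\<Sum>y<a. y) = a * (a - 1)" by (induction a) (auto simp: algebra_simps)
  finally show ?thesis .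
qed

text \<open>A symmetric Latin square on \<open>{..<a}\<close>: by finiteness, solvability also makes
  the solution unique.\<close>

locale commutative_quasigroup =
  fixes a :: nat and f :: "nat \<Rightarrow> nat \<Rightarrow> nat"
  assumes closed: "x < a \<Longrightarrow> y < a \<Longrightarrow> f x y < a"
    and commute: "f x y = f y x"
    and solvable: "x < a \<Longrightarrow> z < a \<Longrightarrow> \<exists>y < a. f x y = z"
begin

lemma in_level_blocks:
  assumes "x < a" "y < a" "x \<noteq> y"
  shows "{3 * x + i, 3 * y + i, 3 * f x y + Suc i mod 3} \<in> level_blocks f a i"
proof (cases "x < y")
  case True
  then show ?thesis using assms unfolding level_blocks_def by (intro image_eqI[of _ _ "(y, x)"]) auto
next
  case False
  then show ?thesis using assms commute[of x y] unfolding level_blocks_def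
    by (intro image_eqI[of _ _ "(x, y)"]) auto
qed

lemma level_blocks_triples:
  assumes "i < 3"
  shows "level_blocks f a i \<subseteq> [{..<3 * a}]\<^bsup>3\<^esup>"
proof
  fix b assume "b \<in> level_blocks f a i"
  then obtain x y where b: "b = {3 * x + i, 3 * y + i, 3 * f x y + Suc i mod 3}" "y < a" "x < y"
    unfolding level_blocks_def by auto
  have "f x y < a" using closed b by simp
  moreover have "i = 0 \<and> Suc i mod 3 = 1 \<or> i = 1 \<and> Suc i mod 3 = 2 \<or> i = 2 \<and> Suc i mod 3 = 0"
    using assms by presburger
  moreover have "3 * x + i \<noteq> 3 * f x y + Suc i mod 3" "3 * y + i \<noteq> 3 * f x y + Suc i mod 3"
    using assms by presburger+
  ultimately show "b \<in> [{..<3 * a}]\<^bsup>3\<^esup>" using b by (auto simp: nsets_def card_insert_if)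
qed

text \<open>Any two levels are equal or cyclically consecutive. Points on one level share a level
  block; for \<open>(x, i)\<close> and \<open>(z, i + 1)\<close> one solves
  \<open>f x y = z\<close>. Only the solution \<open>y = x\<close> yields no level block, and
  \<open>diag\<close> covers that case.\<close>

lemma level_blocks_cover:
  assumes B: "\<And>i. i < 3 \<Longrightarrow> level_blocks f a i \<subseteq> B"
    and diag: "\<And>x i. x < a \<Longrightarrow> i < 3 \<Longrightarrow> \<exists>b \<in> B. 3 * x + i \<in> b \<and> 3 * f x x + Suc i mod 3 \<in> b"
    and pq: "p < 3 * a" "q < 3 * a" "p \<noteq> q"
  shows "\<exists>b \<in> B. p \<in> b \<and> q \<in> b"
proof -
  have consecutive: "\<exists>b \<in> B. 3 * x + i \<in> b \<and> 3 * z + Suc i mod 3 \<in> b" if xz: "x < a" "z < a" "i < 3" for x z i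
  proof -
    obtain y where y: "y < a" "f x y = z" using solvable[OF xz(1,2)] by blast
    show ?thesis
    proof (cases "y = x")
      case True
      then show ?thesis using diag[OF xz(1,3)] y by simp
    next
      case False
      then show ?thesis using in_level_blocks[of x y i] B[OF xz(3)] xz y by blast
    qed
  qed
  obtain x i y j where p: "p = 3 * x + i" "i < 3" and q: "q = 3 * y + j" "j < 3"
    by (rule that[of "p div 3" "p mod 3" "q div 3" "q mod 3"]) simp_all
  then have xy: "x < a" "y < a" using pq by linarith+
  have "j = i \<or> j = Suc i mod 3 \<or> i = Suc j mod 3" using p(2) q(2) unfolding less_3_cases by auto
  then consider "j = i" | "j = Suc i mod 3" | "i = Suc j mod 3" by blast
  then show ?thesis
  proof cases
    case 1
    then have "{3 * x + i, 3 * y + i, 3 * f x y + Suc i mod 3} \<in> B"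
      using in_level_blocks[of x y i] B[OF p(2)] xy pq(3) p q by auto
    then show ?thesis using p q 1 by blast
  next
    case 2
    then show ?thesis using consecutive[OF xy p(2)] p q by simp
  next
    case 3
    then show ?thesis using consecutive[OF xy(2,1) q(2)] p q by auto
  qed
qed

text \<open>With levels 0, 1, 2 played, unplayable and available, blocks from level 0 have two
  played points and an unplayable one, those from level 1 two unplayable and an available one, those
  from level 2 two available and a played one.\<close>

lemma level_block_type:
  assumes "b \<in> level_blocks f a i" "i < 3"
  shows "\<exists>p q r. b = {p, q, r} \<and>
    (p \<in> level a 2 \<and> q \<in> level a 2 \<and> r \<in> level a 0 \<or> q \<notin> level a 2 \<and> r \<in> level a 1)"
proof -
  obtain x y where b: "b = {3 * x + i, 3 * y + i, 3 * f x y + Suc i mod 3}" and xy: "y < a" "x < a"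
    using assms(1) unfolding level_blocks_def by fastforce
  have f: "f x y < a" using closed xy by simp
  consider "i = 0" | "i = 1" | "i = 2" using assms(2) by linarith
  then show ?thesis
  proof cases
    case 1
    then have "3 * y + i \<notin> level a 2" "3 * f x y + Suc i mod 3 \<in> level a 1"
      using f mem_level[of i 2] mem_level[of "Suc i mod 3" 1] by simp_all
    then show ?thesis using b by blast
  next
    case 2
    have "{3 * x + i, 3 * y + i, 3 * f x y + Suc i mod 3} = {3 * f x y + Suc i mod 3, 3 * x + i, 3 * y + i}"
      by blast
    moreover have "3 * x + i \<notin> level a 2" "3 * y + i \<in> level a 1"
      using 2 xy mem_level[of i 2] mem_level[of i 1] by simp_all
    ultimately show ?thesis using b by blast
  next
    case 3
    then have "3 * x + i \<in> level a 2" "3 * y + i \<in> level a 2" "3 * f x y + Suc i mod 3 \<in> level a 0"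
      using f xy mem_level[of i 2] mem_level[of "Suc i mod 3" 0] by simp_all
    then show ?thesis using b by blast
  qed
qed

text \<open>Serves to exhibit an unplayable point on a block with two distinct played
  points.\<close>

lemma solve_off_diagonal:
  assumes "x < a" "z < a" "f x x \<noteq> z"
  obtains y where "y < a" "y \<noteq> x" "f x y = z"
proof -
  obtain y where "y < a" "f x y = z" using solvable[OF assms(1,2)] by blast
  then show ?thesis using that[of y] assms(3) by auto
qed

end

lemma vertical_block_type:
  assumes "x < a"
  shows "\<exists>p q r. {3 * x, 3 * x + 1, 3 * x + 2} = {p, q, r} \<and>
    (p \<in> level a 2 \<and> q \<in> level a 2 \<and> r \<in> level a 0 \<or> q \<notin> level a 2 \<and> r \<in> level a 1)"
proof -
  have "{3 * x, 3 * x + 1, 3 * x + 2} = {3 * x + 2, 3 * x + 0, 3 * x + 1}" by auto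
  moreover have "3 * x + 0 \<notin> level a 2" "3 * x + 1 \<in> level a 1"
    using assms mem_level[of 0 2 x a] mem_level[of 1 1 x a] by simp_all
  ultimately show ?thesis by blast
qed

lemma card_all_level_blocks: "2 * card (\<Union>i<3. level_blocks f a i) \<le> 3 * (a * (a - 1))"
proof -
  have "card (\<Union>i<(3::nat). level_blocks f a i) \<le> (\<Sum>i<3. card (level_blocks f a i))"
    by (rule card_UN_le) simp
  then have "2 * card (\<Union>i<(3::nat). level_blocks f a i) \<le> (\<Sum>i<3. 2 * card (level_blocks f a i))"
    by (simp flip: sum_distrib_left)
  also have "\<dots> \<le> (\<Sum>i<(3::nat). a * (a - 1))" by (intro sum_mono card_level_blocks)
  finally show ?thesis by simp
qed

section \<open>Odd case: the Bose construction\<close>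

lemma bose_embedding:
  assumes a: "odd a" "a \<ge> 3"
  shows "\<exists>(V :: nat set) B. steiner_triple_system (3 * a) V B \<and> complete_graph_embedded a V B"
proof -
  \<comment> \<open>\<open>h\<close> is the inverse of 2 modulo \<open>a\<close>, so
    \<open>f\<close> is the mean of two residues: an idempotent commutative quasigroup.\<close>
  define h where "h = (a + 1) div 2"
  have h: "2 * h = a + 1" unfolding h_def using a by (intro dvd_mult_div_cancel) simp
  define f where "f = (\<lambda>x y. (x + y) * h mod a)"
  have f_diag: "f x x = x" if x: "x < a" for x
  proof -
    have "(x + x) * h = x * (2 * h)" by (simp add: algebra_simps)
    also have "\<dots> = x + a * x" unfolding h by (simp add: algebra_simps)
    finally show ?thesis using x unfolding f_def by simp
  qed
  interpret commutative_quasigroup a f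
  proof
    fix x z assume xz: "x < a" "z < a"
    \<comment> \<open>The solution is \<open>2 * z - x\<close> modulo \<open>a\<close>, with
      \<open>a - x\<close> in place of the negative of \<open>x\<close>.\<close>
    have "(x + (2 * z + (a - x))) * h = z * (2 * h) + a * h" using xz by (simp add: algebra_simps)
    also have "\<dots> = z + a * (z + h)" unfolding h by (simp add: algebra_simps)
    finally have "f x ((2 * z + (a - x)) mod a) = z"
      using xz unfolding f_def by (metis mod_add_right_eq mod_less mod_mult_left_eq mod_mult_self2)
    then show "\<exists>y < a. f x y = z" using xz by (metis mod_less_divisor gr_implies_not0 gr0I)
  qed (use a in \<open>auto simp: f_def add.commute\<close>)
  define W where "W = (\<lambda>x. {3 * x, 3 * x + 1, 3 * x + 2}) ` {..<a}"
  define B where "B = (\<Union>i<3. level_blocks f a i) \<union> W"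
  have sub: "level_blocks f a i \<subseteq> B" if "i < 3" for i using that unfolding B_def by blast
  have sts: "steiner_triple_system (3 * a) {..<3 * a} B"
  proof (rule steiner_triple_systemI)
    have "W \<subseteq> [{..<3 * a}]\<^bsup>3\<^esup>" unfolding W_def by (auto simp: nsets_def card_insert_if)
    then show "B \<subseteq> [{..<3 * a}]\<^bsup>3\<^esup>" unfolding B_def using level_blocks_triples by blast
    have "card W \<le> a" unfolding W_def using card_image_le[of "{..<a}"] by fastforce
    then have "6 * card B \<le> 9 * (a * (a - 1)) + 6 * a"
      using card_all_level_blocks[of f a] card_Un_le[of "\<Union>i<3. level_blocks f a i" W]
      unfolding B_def by linarith
    also have "\<dots> = 3 * a * (3 * a - 1)" using a(2) by (cases a) (auto simp: algebra_simps)
    finally show "6 * card B \<le> 3 * a * (3 * a - 1)" .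
    fix p q assume pq: "p \<in> {..<3 * a}" "q \<in> {..<3 * a}" "p \<noteq> q"
    show "\<exists>b \<in> B. p \<in> b \<and> q \<in> b"
    proof (rule level_blocks_cover[OF sub])
      fix x i :: nat assume x: "x < a" "i < 3"
      have "{3 * x, 3 * x + 1, 3 * x + 2} \<in> B" using x unfolding B_def W_def by blast
      then show "\<exists>b \<in> B. 3 * x + i \<in> b \<and> 3 * f x x + Suc i mod 3 \<in> b"
        using x(2) unfolding f_diag[OF x(1)] less_3_cases by (intro bexI) auto
    qed (use pq in auto)
  qed simp_all
  have "complete_graph_embedded a {..<3 * a} B"
  proof (rule complete_graph_embeddedI[OF sts level_union])
    show "level a 0 \<inter> level a 2 = {}" "level a 0 \<inter> level a 1 = {}" "level a 2 \<inter> level a 1 = {}"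
      by (simp_all add: level_disjoint)
    show "card (level a 2) = a" by (rule card_level)
  next
    fix b assume "b \<in> B"
    then consider i where "i < 3" "b \<in> level_blocks f a i" | "b \<in> W" unfolding B_def by auto
    then show "\<exists>x y z. b = {x, y, z} \<and>
      (x \<in> level a 2 \<and> y \<in> level a 2 \<and> z \<in> level a 0 \<or> y \<notin> level a 2 \<and> z \<in> level a 1)"
      by cases (use level_block_type vertical_block_type W_def in auto)
  next
    fix u assume "u \<in> level a 1"
    then obtain w where w: "u = 3 * w + 1" "w < a" unfolding level_def by auto
    \<comment> \<open>Any \<open>x\<close> other than \<open>w\<close> works:
      \<open>f x x = x\<close> keeps the solution of \<open>f x y = w\<close> off the
      diagonal.\<close>
    define x where "x = (if w = 0 then 1 else 0 :: nat)"
    have x: "x < a" "x \<noteq> w" using a(2) unfolding x_def by auto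
    then obtain y where y: "y < a" "y \<noteq> x" "f x y = w" using solve_off_diagonal[of x w] f_diag w(2) by metis
    then have "{3 * x + 0, 3 * y + 0, 3 * f x y + Suc 0 mod 3} \<in> B" using in_level_blocks[of x y 0] sub[of 0] x(1) by auto
    then show "\<exists>x \<in> level a 0. \<exists>y \<in> level a 0. {x, y, u} \<in> B" using x y w unfolding level_def by auto
  qed
  then show ?thesis using sts by blast
qed

section \<open>Even case: the Skolem construction\<close>

text \<open>Addition modulo \<open>a\<close> with its values relabelled by a bijection: even
  residues go to the lower half, odd ones to the upper half.\<close>

lemma skolem_quasigroup:
  assumes a: "a = 2 * n" "n > 0"
    and f: "\<And>x y. f x y = (let s = (x + y) mod a in if even s then s div 2 else n + s div 2)"
  shows "commutative_quasigroup a f"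
proof
  fix x y
  show "f x y = f y x" by (simp add: f add.commute)
  have "(if even s then s div 2 else n + s div 2) < a" if "s < a" for s using that a(1) by auto
  then show "f x y < a" unfolding f Let_def by this (use a in simp)
next
  fix x z assume xz: "x < a" "z < a"
  \<comment> \<open>The residue with label \<open>z\<close>; then \<open>y\<close> is
    \<open>s - x\<close> modulo \<open>a\<close>.\<close>
  define s where "s = (if z < n then 2 * z else 2 * (z - n) + 1)"
  have s: "s < a" using xz a unfolding s_def by auto
  have "(x + (s + (a - x)) mod a) mod a = (s + a) mod a" using xz by (simp add: mod_add_right_eq)
  then have eq: "(x + (s + (a - x)) mod a) mod a = s" using s by simp
  have "f x ((s + (a - x)) mod a) = z" unfolding f Let_def eq using xz a unfolding s_def by auto
  moreover have "(s + (a - x)) mod a < a" using a by simp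
  ultimately show "\<exists>y < a. f x y = z" by blast
qed

lemma skolem_embedding:
  assumes a: "even a" "a \<ge> 3"
  shows "\<exists>(V :: nat set) B. steiner_triple_system (3 * a + 1) V B \<and> complete_graph_embedded a V B"
proof -
  obtain n where n: "a = 2 * n" using a by blast
  define m where "m = n - 1"
  have m: "n = m + 1" "m \<ge> 1" "a = 2 * m + 2" using a n unfolding m_def by auto
  define f where "f = (\<lambda>x y. let s = (x + y) mod a in if even s then s div 2 else n + s div 2)"
  interpret commutative_quasigroup a f
    by (rule skolem_quasigroup[of a n]) (use n m f_def in auto)
  \<comment> \<open>Half-idempotence: the diagonal runs twice through the lower half.\<close>
  have f_diag: "f x x = (if x < n then x else x - n)" if x: "x < a" for x
  proof -
    have "(x + x) mod a = (if x < n then 2 * x else 2 * (x - n))"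
      using x n by (auto simp: mod_if)
    then show ?thesis unfolding f_def by simp
  qed
  have f_top: "f x y = 2 * m + 1" if "x + y = 2 * m + 1" for x y
    unfolding f_def Let_def that using m by simp
  \<comment> \<open>Vertical blocks handle the diagonal for \<open>x < n\<close>. In the upper half
    \<open>f (n + x) (n + x) = x\<close>, so the blocks in \<open>Z\<close> join
    \<open>(n + x, i)\<close> and \<open>(x, i + 1)\<close> to infinity.\<close>
  define W where "W = (\<lambda>x. {3 * x, 3 * x + 1, 3 * x + 2}) ` {..<n}"
  define Z where "Z = (\<lambda>(i, x). {3 * (n + x) + i, 3 * x + Suc i mod 3, 3 * a}) ` ({..<3} \<times> {..<n})"
  define B where "B = (\<Union>i<3. level_blocks f a i) \<union> (W \<union> Z)"
  have sub: "level_blocks f a i \<subseteq> B" if "i < 3" for i using that unfolding B_def by blast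
  have W: "{3 * x, 3 * x + 1, 3 * x + 2} \<in> B" if "x < n" for x
    using that unfolding B_def W_def by blast
  have Z: "{3 * (n + x) + i, 3 * x + Suc i mod 3, 3 * a} \<in> B" if "i < 3" "x < n" for i x
    using that unfolding B_def Z_def by (intro UnI2 image_eqI[of _ _ "(i, x)"]) auto
  have sts: "steiner_triple_system (3 * a + 1) {..<3 * a + 1} B"
  proof (rule steiner_triple_systemI)
    have "W \<subseteq> [{..<3 * a + 1}]\<^bsup>3\<^esup>" unfolding W_def n by (auto simp: nsets_def card_insert_if)
    moreover have "Z \<subseteq> [{..<3 * a + 1}]\<^bsup>3\<^esup>"
    proof
      fix b assume "b \<in> Z"
      then obtain i x where b: "b = {3 * (n + x) + i, 3 * x + Suc i mod 3, 3 * a}" "i < 3" "x < n"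
        unfolding Z_def by auto
      have "3 * x + j < 3 * (n + x) + i" if "j < 3" for j using that m(1) by simp
      then have "3 * x + Suc i mod 3 < 3 * (n + x) + i" by simp
      moreover have "3 * (n + x) + i < 3 * a" using b(2,3) n by simp
      ultimately show "b \<in> [{..<3 * a + 1}]\<^bsup>3\<^esup>" unfolding b(1) by (simp add: nsets_def card_insert_if)
    qed
    moreover have "level_blocks f a i \<subseteq> [{..<3 * a + 1}]\<^bsup>3\<^esup>" if "i < 3" for i
      using level_blocks_triples[OF that] nsets_mono[of "{..<3 * a}" "{..<3 * a + 1}" 3] by auto
    ultimately show "B \<subseteq> [{..<3 * a + 1}]\<^bsup>3\<^esup>" unfolding B_def by blast
    have "card W \<le> n" "card Z \<le> 3 * n" unfolding W_def Z_def
      using card_image_le[of "{..<n}"] card_image_le[of "{..<3::nat} \<times> {..<n}"] by fastforce+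
    then have "6 * card B \<le> 9 * (a * (a - 1)) + 24 * n"
      using card_all_level_blocks[of f a] card_Un_le[of "\<Union>i<3. level_blocks f a i" "W \<union> Z"] card_Un_le[of W Z]
      unfolding B_def by linarith
    also have "\<dots> = (3 * a + 1) * (3 * a + 1 - 1)" unfolding m by (simp add: algebra_simps)
    finally show "6 * card B \<le> (3 * a + 1) * (3 * a + 1 - 1)" .
    have infinity: "\<exists>b \<in> B. p \<in> b \<and> 3 * a \<in> b" if p: "p < 3 * a" for p
    proof -
      define x i where "x = p div 3" and "i = p mod 3"
      have xi: "p = 3 * x + i" "i < 3" "x < a" using p unfolding x_def i_def by auto
      show ?thesis
      proof (cases "x < n")
        case True
        \<comment> \<open>For \<open>x < n\<close> the point \<open>(x, i)\<close> is the lower-half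
          point of an infinity block, which is indexed by the preceding level
          \<open>(i + 2) mod 3\<close>.\<close>
        have j: "(i + 2) mod 3 < 3" "Suc ((i + 2) mod 3) mod 3 = i" using xi(2) unfolding less_3_cases by auto
        show ?thesis using Z[OF j(1) True] unfolding j(2) xi(1) by (rule bexI[rotated]) simp
      next
        case False
        then have "x - n < n" "n + (x - n) = x" using xi(3) n by auto
        then show ?thesis using Z[OF xi(2), of "x - n"] unfolding xi(1) by (intro bexI[rotated]) auto
      qed
    qed
    fix p q assume pq: "p \<in> {..<3 * a + 1}" "q \<in> {..<3 * a + 1}" "p \<noteq> q"
    have finite_points: "\<exists>b \<in> B. p \<in> b \<and> q \<in> b" if "p < 3 * a" "q < 3 * a"
    proof (rule level_blocks_cover[OF sub _ that pq(3)])
      fix x i :: nat assume x: "x < a" "i < 3"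
      show "\<exists>b \<in> B. 3 * x + i \<in> b \<and> 3 * f x x + Suc i mod 3 \<in> b"
      proof (cases "x < n")
        case True
        then show ?thesis using x(2) unfolding f_diag[OF x(1)] less_3_cases
          by (intro bexI[OF _ W[OF True]]) auto
      next
        case False
        then have "x - n < n" "n + (x - n) = x" using x(1) n by auto
        then show ?thesis using Z[OF x(2), of "x - n"] False unfolding f_diag[OF x(1)]
          by (intro bexI[rotated]) auto
      qed
    qed
    consider "p < 3 * a" "q < 3 * a" | "p < 3 * a" "q = 3 * a" | "p = 3 * a" "q < 3 * a"
      using pq by fastforce
    then show "\<exists>b \<in> B. p \<in> b \<and> q \<in> b"
    proof cases
      case 1
      then show ?thesis by (rule finite_points)
    next
      case 2
      then show ?thesis using infinity[of p] by simp
    next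
      case 3
      then show ?thesis using infinity[of q] by (simp add: conj_commute)
    qed
  qed simp_all
  \<comment> \<open>The Pasch configuration: \<open>3 * a\<close> is the point at infinity. The unplayable point \<open>u\<close> keeps its
    block with the played points \<open>(0, 0)\<close> and \<open>(2 * m + 1, 0)\<close>.\<close>
  define u b c d e where
    pts: "u = 3 * (2 * m + 1) + 1" "b = 3 * m + 0" "c = 3 * (m + 1) + 0" "d = 3 * 0 + (1::nat)" "e = 3 * (2 * m + 1) + 2"
  define old where "old = {{u, b, c}, {u, d, e}, {3 * a, b, e}, {3 * a, c, d}}"
  define new where "new = {{3 * a, b, c}, {3 * a, d, e}, {u, b, e}, {u, c, d}}"
  have dist: "distinct [u, 3 * a, b, c, d, e]" using m unfolding pts by (simp; presburger)
  \<comment> \<open>The blocks through \<open>u\<close> come from \<open>f_top\<close> with the sums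
    \<open>m + (m + 1)\<close> and \<open>0 + (2 * m + 1)\<close>; the other two are infinity
    blocks, using \<open>n = m + 1\<close>.\<close>
  have "{b, c, u} \<in> B" using in_level_blocks[of m "m + 1" 0] sub[of 0] m(3) f_top[of m "m + 1"] unfolding pts by (simp add: subset_iff)
  moreover have "{d, u, e} \<in> B"
    using in_level_blocks[of 0 "2 * m + 1" 1] sub[of 1] m(3) f_top[of 0 "2 * m + 1"] unfolding pts by (simp add: subset_iff)
  moreover have "{e, b, 3 * a} \<in> B" using Z[of 2 m] m unfolding pts by (simp add: algebra_simps)
  moreover have "{c, d, 3 * a} \<in> B" using Z[of 0 0] m unfolding pts by simp
  ultimately have "old \<subseteq> B" unfolding old_def by (simp add: insert_commute)
  then have sts': "steiner_triple_system (3 * a + 1) {..<3 * a + 1} (B - old \<union> new)"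
    using pasch_switch[OF sts dist] unfolding old_def new_def by blast
  \<comment> \<open>After the switch infinity shares a block with the played points \<open>b\<close>
    and \<open>c\<close>, so it joins the unplayable level.\<close>
  let ?U = "insert (3 * a) (level a 1)"
  let ?good = "\<lambda>b. \<exists>x y z. b = {x, y, z} \<and>
    (x \<in> level a 2 \<and> y \<in> level a 2 \<and> z \<in> level a 0 \<or> y \<notin> level a 2 \<and> z \<in> ?U)"
  have lev: "b \<in> level a 0" "c \<in> level a 0" "u \<in> level a 1" "b \<notin> level a 2" "c \<notin> level a 2" "d \<notin> level a 2"
    unfolding pts using m by (simp_all only: mem_level) auto
  have "complete_graph_embedded a {..<3 * a + 1} (B - old \<union> new)"
  proof (rule complete_graph_embeddedI[OF sts', of "level a 0" "level a 2" ?U])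
    have "3 * a \<notin> level a i" if "i < 3" for i using mem_level[of 0 i a a] that by simp
    then show "level a 0 \<inter> level a 2 = {}" "level a 0 \<inter> ?U = {}" "level a 2 \<inter> ?U = {}"
      by (simp_all add: level_disjoint)
    have "{..<3 * a + 1} = insert (3 * a) {..<3 * a}" by auto
    then show "{..<3 * a + 1} = level a 0 \<union> level a 2 \<union> ?U" using level_union[of a] by auto
    show "card (level a 2) = a" by (rule card_level)
  next
    fix k assume "k \<in> B - old \<union> new"
    then consider i where "i < 3" "k \<in> level_blocks f a i" | "k \<in> W" | "k \<in> Z" | "k \<in> new" unfolding B_def by auto
    then show "?good k"
    proof cases
      case 1
      then show ?thesis using level_block_type[OF 1(2,1)] by blast
    next
      case 2
      then obtain x where "k = {3 * x, 3 * x + 1, 3 * x + 2}" "x < a" using n unfolding W_def by auto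
      then show ?thesis using vertical_block_type[of x a] by blast
    next
      case 3
      then obtain i x where k: "k = {3 * (n + x) + i, 3 * x + Suc i mod 3, 3 * a}" "i < 3" "x < n"
        unfolding Z_def by auto
      show ?thesis
      proof (cases "i = 2")
        case True
        then have "3 * x + Suc i mod 3 \<notin> level a 2" using mem_level[of 0 2 x a] by simp
        then show ?thesis using k(1) by blast
      next
        case False
        have "3 * (n + x) + i \<notin> level a 2" using mem_level[of i 2 "n + x" a] False k(2) by simp
        moreover have "k = {3 * x + Suc i mod 3, 3 * (n + x) + i, 3 * a}" using k(1) by auto
        ultimately show ?thesis by blast
      qed
    next
      case 4
      have "k = {b, c, 3 * a} \<or> k = {e, d, 3 * a} \<or> k = {e, b, u} \<or> k = {c, d, u}"
        using 4 unfolding new_def by (auto simp: insert_commute)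
      then show ?thesis using lev by blast
    qed
  next
    fix w assume "w \<in> ?U"
    then consider "w = 3 * a" | "w = u" | z where "w = 3 * z + 1" "z < a" "w \<noteq> u"
      unfolding level_def by auto
    then show "\<exists>x \<in> level a 0. \<exists>y \<in> level a 0. {x, y, w} \<in> B - old \<union> new"
    proof cases
      case 1
      then have "{b, c, w} \<in> new" unfolding new_def by (simp add: insert_commute)
      then show ?thesis using lev by blast
    next
      case 2
      let ?k = "{3 * 0 + 0, 3 * (2 * m + 1) + 0, w}"
      have "?k \<in> B"
        using in_level_blocks[of 0 "2 * m + 1" 0] sub[of 0] m(3) f_top[of 0 "2 * m + 1"] unfolding 2 pts by (simp add: subset_iff)
      \<comment> \<open>The old blocks through infinity differ from \<open>?k\<close>, which avoids
        infinity; those through \<open>u\<close> do not contain \<open>0\<close>, where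
        \<open>m \<ge> 1\<close> ensures \<open>b \<noteq> 0\<close>.\<close>
      moreover have "0 \<notin> {u, b, c}" "0 \<notin> {u, d, e}" "3 * a \<notin> ?k" using m unfolding 2 pts by simp_all
      then have "?k \<notin> old" unfolding old_def by auto
      ultimately have "?k \<in> B - old \<union> new" by blast
      moreover have "3 * 0 + 0 \<in> level a 0" "3 * (2 * m + 1) + 0 \<in> level a 0"
        using m by (simp_all only: mem_level) auto
      ultimately show ?thesis by blast
    next
      case 3
      \<comment> \<open>Choosing \<open>x < n\<close> gives \<open>f x x = x\<close>, which differs
        from \<open>z\<close>; the value 1 is allowed because \<open>n \<ge> 2\<close>. The
        resulting block avoids \<open>u\<close> and infinity, one of which lies on each old block,
        so it survives the switch.\<close>
      define x where "x = (if z = 0 then 1 else 0 :: nat)"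
      have x: "x < a" "x < n" "x \<noteq> z" using m unfolding x_def by auto
      then obtain y where y: "y < a" "y \<noteq> x" "f x y = z"
        using solve_off_diagonal[of x z] f_diag[of x] 3(2) by auto
      let ?k = "{3 * x + 0, 3 * y + 0, w}"
      have "?k \<in> B" using in_level_blocks[of x y 0] sub[of 0] x y 3(1) by auto
      moreover have "3 * x + 0 \<noteq> u" "3 * y + 0 \<noteq> u" unfolding pts by presburger+
      then have "u \<notin> ?k" "3 * a \<notin> ?k" using x y 3 by auto
      moreover have "\<forall>k \<in> old. u \<in> k \<or> 3 * a \<in> k" unfolding old_def by simp
      ultimately have "?k \<in> B - old \<union> new" by (intro UnI1 DiffI) metis+
      moreover have "3 * x + 0 \<in> level a 0" "3 * y + 0 \<in> level a 0" using x y by (simp_all only: mem_level)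
      ultimately show ?thesis by blast
    qed
  qed
  then show ?thesis using sts' by blast
qed

text \<open>The bound on \<open>a\<close> excludes genuine exceptions: one point is an STS of order
  1 giving \<open>a = 1\<close>, and one played point in the STS of order 3 gives
  \<open>a = 2\<close>. Nonexistence is stated over an arbitrary type of points.\<close>

theorem theorem3p1:
  fixes a :: nat
  assumes "a \<ge> 3"
  shows "(odd a \<longrightarrow>
            (\<exists>(V :: nat set) B. steiner_triple_system (3 * a) V B \<and> complete_graph_embedded a V B) \<and>
            (\<forall>v < 3 * a. \<forall>(V :: 'p set) B. steiner_triple_system v V B \<longrightarrow>
               \<not> complete_graph_embedded a V B)) \<and>
         (even a \<longrightarrow>
            (\<exists>(V :: nat set) B. steiner_triple_system (3 * a + 1) V B \<and> complete_graph_embedded a V B) \<and>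
            (\<forall>v < 3 * a + 1. \<forall>(V :: 'p set) B. steiner_triple_system v V B \<longrightarrow>
               \<not> complete_graph_embedded a V B))"
proof (intro conjI impI allI notI)
  assume "odd a"
  then show "\<exists>(V :: nat set) B. steiner_triple_system (3 * a) V B \<and> complete_graph_embedded a V B"
    using bose_embedding assms by blast
next
  fix v and V :: "'p set" and B
  assume "odd a" "v < 3 * a" "steiner_triple_system v V B" "complete_graph_embedded a V B"
  then show False using complete_graph_order_bound(1)[of v V B a] assms by simp
next
  assume "even a"
  then show "\<exists>(V :: nat set) B. steiner_triple_system (3 * a + 1) V B \<and> complete_graph_embedded a V B"
    using skolem_embedding assms by blast
next
  fix v and V :: "'p set" and B
  assume "even a" "v < 3 * a + 1" "steiner_triple_system v V B" "complete_graph_embedded a V B"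
  then show False using complete_graph_order_bound(2)[of v V B a] assms by simp
qed

end
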